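(* Let $n\in\mathbb{N}$, and let $T\in\mathbb{B}(\mathcal{H})$ be an $n$-power quasinormal operator. Then there exist unique positive integers $d$ and $q$ such that $$\mathcal{PQ}(T)=\{d(q+k):k\in\mathbb{N}_{0}\}=\{dq,d(q+1),d(q+2),\cdots\}.$$ More precisely, $d=\min\mathcal{PQ}(\widetilde{T})$ and $q=\frac{m}{d}$, where $m=\min\mathcal{PQ}(T)$ and $\widetilde{T}$ is the upper-left entry in the matrix representation $$T=\begin{bmatrix}\widetilde{T}&X\\0&N\end{bmatrix}$$ with respect to the decomposition $\mathcal{H}=\overline{\operatorname{ran}T^m}\oplus\ker (T^\ast)^m$.
   Context: $\mathbb{N}$ denotes the positive integers and $\mathbb{N}_0$ the nonnegative integers. $\mathbb{B}(\mathcal{H})$ is the algebra of bounded linear operators on a complex Hilbert space $\mathcal{H}$. Write $[S,T]=ST-TS$. $T$ is $n$-power quasinormal if $[T^n,T^*T]=0$. The power-quasinormality index set of a bounded operator $T$ is $\mathcal{PQ}(T)=\{n\in\mathbb{N}:[T^n,T^\ast T]=0\}$. The subspace $\overline{\operatorname{ran}T^m}$ is $T$-invariant, and $\widetilde T=T|_{\overline{\operatorname{ran}T^m}}$ is regarded as an operator on the Hilbert space $\overline{\operatorname{ran}T^m}$ (with adjoint taken there). *)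

theory Defs
  imports "HOL-Analysis.Analysis"
begin

(* A complex Hilbert space. The real inner product, and hence the norm and the
   topology, are those induced by the complex inner product (inner_cinner).
   Positive definiteness of cinner follows, since cinner x x is real and its real
   part is positive definite by real_inner. cinner is linear in its first argument. *)
class complex_hilbert_space = real_inner + complete_space +
  fixes scaleC :: "complex \<Rightarrow> 'a \<Rightarrow> 'a"
    and cinner :: "'a \<Rightarrow> 'a \<Rightarrow> complex"
  assumes scaleC_add_right: "scaleC c (x + y) = scaleC c x + scaleC c y"
    and scaleC_add_left: "scaleC (b + c) x = scaleC b x + scaleC c x"
    and scaleC_scaleC: "scaleC b (scaleC c x) = scaleC (b * c) x"
    and scaleR_scaleC: "scaleR r x = scaleC (complex_of_real r) x"
    and cinner_commute: "cinner x y = cnj (cinner y x)"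
    and cinner_add_left: "cinner (x + y) z = cinner x z + cinner y z"
    and cinner_scaleC_left: "cinner (scaleC c x) y = c * cinner x y"
    and inner_cinner: "inner x y = Re (cinner x y)"

instantiation complex :: complex_hilbert_space
begin

definition scaleC_complex :: "complex \<Rightarrow> complex \<Rightarrow> complex"
  where "scaleC_complex c x = c * x"

definition cinner_complex :: "complex \<Rightarrow> complex \<Rightarrow> complex"
  where "cinner_complex x y = x * cnj y"

instance
  by standard
    (simp_all add: scaleC_complex_def cinner_complex_def inner_complex_def
      algebra_simps scaleR_conv_of_real)

end

definition closed_csubspace :: "'a::complex_hilbert_space set \<Rightarrow> bool" where
  "closed_csubspace V \<longleftrightarrow> closed V \<and> 0 \<in> V \<and>
     (\<forall>x\<in>V. \<forall>y\<in>V. x + y \<in> V) \<and> (\<forall>c. \<forall>x\<in>V. scaleC c x \<in> V)"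

(* Bounded complex-linear operators from the subspace V to the subspace W. An operator
   on a subspace is a function on the whole type whose values off the subspace are
   irrelevant; operators on the full space are the case V = W = UNIV. *)
definition bounded_op :: "'a::complex_hilbert_space set \<Rightarrow> 'a set \<Rightarrow> ('a \<Rightarrow> 'a) \<Rightarrow> bool" where
  "bounded_op V W A \<longleftrightarrow> A \<in> V \<rightarrow> W \<and>
     (\<forall>x\<in>V. \<forall>y\<in>V. A (x + y) = A x + A y) \<and>
     (\<forall>c. \<forall>x\<in>V. A (scaleC c x) = scaleC c (A x)) \<and>
     (\<exists>B. \<forall>x\<in>V. norm (A x) \<le> B * norm x)"

(* The adjoint of A as an operator on the Hilbert space V. For a bounded operator on
   a closed subspace V and y in V, the described vector exists by the Riesz
   representation theorem and is unique. *)
definition adjoint_on :: "'a::complex_hilbert_space set \<Rightarrow> ('a \<Rightarrow> 'a) \<Rightarrow> 'a \<Rightarrow> 'a" where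
  "adjoint_on V A y = (THE z. z \<in> V \<and> (\<forall>x\<in>V. cinner (A x) y = cinner x z))"

definition commutator :: "('a::ab_group_add \<Rightarrow> 'a) \<Rightarrow> ('a \<Rightarrow> 'a) \<Rightarrow> 'a \<Rightarrow> 'a" where
  "commutator S T = (\<lambda>x. S (T x) - T (S x))"

definition power_quasinormal_on ::
    "'a::complex_hilbert_space set \<Rightarrow> nat \<Rightarrow> ('a \<Rightarrow> 'a) \<Rightarrow> bool" where
  "power_quasinormal_on V n A \<longleftrightarrow>
     (\<forall>x\<in>V. commutator (A ^^ n) (adjoint_on V A \<circ> A) x = 0)"

definition PQ_on :: "'a::complex_hilbert_space set \<Rightarrow> ('a \<Rightarrow> 'a) \<Rightarrow> nat set" where
  "PQ_on V A = {n. 0 < n \<and> power_quasinormal_on V n A}"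

definition orthogonal_decomposition :: "'a::complex_hilbert_space set \<Rightarrow> 'a set \<Rightarrow> bool" where
  "orthogonal_decomposition M K \<longleftrightarrow> closed_csubspace M \<and> closed_csubspace K \<and>
     (\<forall>u\<in>M. \<forall>v\<in>K. cinner u v = 0) \<and> (\<forall>x. \<exists>u\<in>M. \<exists>v\<in>K. x = u + v)"

(* T = [A X; C N] with respect to the orthogonal sum of M and K. *)
definition has_matrix :: "'a::complex_hilbert_space set \<Rightarrow> 'a set \<Rightarrow> ('a \<Rightarrow> 'a) \<Rightarrow>
    ('a \<Rightarrow> 'a) \<Rightarrow> ('a \<Rightarrow> 'a) \<Rightarrow> ('a \<Rightarrow> 'a) \<Rightarrow> ('a \<Rightarrow> 'a) \<Rightarrow> bool" where
  "has_matrix M K T A X C N \<longleftrightarrow>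
     bounded_op M M A \<and> bounded_op K M X \<and> bounded_op M K C \<and> bounded_op K K N \<and>
     (\<forall>u\<in>M. \<forall>v\<in>K. T (u + v) = (A u + X v) + (C u + N v))"

end

theory Submission
  imports Defs
begin

text \<open>
  Write \<open>S\<close> for the adjoint of \<open>T\<close> and \<open>A = S T\<close>. Let \<open>m\<close> be the least index for which \<open>T\<^sup>m\<close>
  commutes with \<open>A\<close>, \<open>M\<close> the closure of the range of \<open>T\<^sup>m\<close>, and \<open>K\<close> the kernel of \<open>S\<^sup>m\<close>, so that
  \<open>M\<close> and \<open>K\<close> are orthogonal complements of each other.

  Everything rests on the fact that \<open>T\<close> is injective on \<open>M\<close> (lemma \<open>inj_on_M\<close>). Taking adjoints,
  \<open>S\<^sup>m\<close> commutes with \<open>A\<close> too. If \<open>T y = 0\<close>, then \<open>A S\<^sup>m y = S\<^sup>m A y = 0\<close>, and \<open>A\<close> and \<open>T\<close> have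
  the same kernel, so \<open>T S\<^sup>m y = 0\<close>; hence \<open>\<parallel>S\<^sup>m y\<parallel>\<^sup>2 = \<langle>T\<^sup>m S\<^sup>m y, y\<rangle> = 0\<close>. Thus the kernel of \<open>T\<close> is
  contained in \<open>K\<close>, which meets \<open>M\<close> only in zero.

  The space \<open>M\<close> is invariant under \<open>T\<close> and \<open>A\<close>, so the adjoint of the restriction \<open>T'\<close> of \<open>T\<close> to
  \<open>M\<close>, composed with \<open>T'\<close>, is the restriction of \<open>A\<close>. Two consequences of injectivity follow.
  If \<open>T\<^sup>i\<close> and \<open>T\<^sup>j\<close> with \<open>i < j\<close> commute with \<open>A\<close> on \<open>M\<close>, then \<open>T\<^sup>i\<close> may be cancelled, so
  \<open>T\<close> to the power \<open>j - i\<close> commutes with \<open>A\<close> on \<open>M\<close>; the index set of \<open>T'\<close> is therefore closed under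
  sums and positive differences and consists of all positive multiples of its least element \<open>d\<close>.
  If \<open>j \<ge> m\<close> and \<open>T\<^sup>j\<close> commutes with \<open>A\<close> on \<open>M\<close>, then \<open>D = T\<^sup>j A - A T\<^sup>j\<close> takes its values in \<open>M\<close>
  and satisfies \<open>T\<^sup>m D = D T\<^sup>m = 0\<close>, so \<open>D = 0\<close>. Hence the index set of \<open>T\<close> consists of the
  multiples of \<open>d\<close> that are at least \<open>m\<close>, and \<open>d\<close> divides \<open>m\<close>.

  The existence of adjoints and of the orthogonal decomposition is obtained from the projection
  theorem for closed subspaces of a complete inner product space (lemma \<open>orthogonal_projection_ex\<close>).
\<close>

section \<open>Complex inner products\<close>

lemma scaleC_one [simp]: "scaleC 1 (x::'a::complex_hilbert_space) = x"
  using scaleR_scaleC[of 1 x] by simp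

lemma scaleC_zero_left [simp]: "scaleC 0 (x::'a::complex_hilbert_space) = 0"
  using scaleR_scaleC[of 0 x] by simp

lemma scaleC_zero_right [simp]: "scaleC c (0::'a::complex_hilbert_space) = 0"
  using scaleC_add_right[of c 0 "0::'a"] by simp

lemma scaleC_diff_right:
  "scaleC c (x - y) = scaleC c x - scaleC c (y::'a::complex_hilbert_space)"
  using scaleC_add_right[of c "x - y" y] by (simp add: algebra_simps)

lemma cinner_zero_left [simp]: "cinner 0 (y::'a::complex_hilbert_space) = 0"
  using cinner_add_left[of 0 "0::'a" y] by simp

lemma cinner_diff_left:
  "cinner (x - y) z = cinner x z - cinner y (z::'a::complex_hilbert_space)"
  using cinner_add_left[of "x - y" y z] by simp

lemma cinner_add_right:
  "cinner x (y + z) = cinner x y + cinner x (z::'a::complex_hilbert_space)"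
  by (metis cinner_add_left cinner_commute complex_cnj_add)

lemma cinner_diff_right:
  "cinner x (y - z) = cinner x y - cinner x (z::'a::complex_hilbert_space)"
  by (metis cinner_diff_left cinner_commute complex_cnj_diff)

lemma cinner_zero_right [simp]: "cinner (x::'a::complex_hilbert_space) 0 = 0"
  using cinner_add_right[of x 0 0] by simp

lemma cinner_scaleC_right:
  "cinner x (scaleC c y) = cnj c * cinner x (y::'a::complex_hilbert_space)"
  by (metis cinner_scaleC_left cinner_commute complex_cnj_mult)

lemma cinner_eq_zero_commute:
  "cinner x y = 0 \<longleftrightarrow> cinner y (x::'a::complex_hilbert_space) = 0"
  by (metis cinner_commute complex_cnj_zero)

lemma cinner_self: "cinner x (x::'a::complex_hilbert_space) = complex_of_real ((norm x)\<^sup>2)"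
proof -
  have "Im (cinner x x) = 0"
    using cinner_commute[of x x] by (metis complex_cnj complex.sel(2) complex_surj equal_neg_zero)
  moreover have "Re (cinner x x) = (norm x)\<^sup>2"
    using inner_cinner[of x x] by (simp add: power2_norm_eq_inner)
  ultimately show ?thesis
    by (simp add: complex_eq_iff)
qed

lemma cinner_self_eq_zero [simp]: "cinner x x = 0 \<longleftrightarrow> x = (0::'a::complex_hilbert_space)"
  by (simp add: cinner_self)

lemma eq_if_cinner_eq:
  fixes x y :: "'a::complex_hilbert_space"
  assumes "\<And>u. cinner u x = cinner u y"
  shows "x = y"
proof -
  have "cinner (x - y) (x - y) = 0"
    using assms by (simp add: cinner_diff_right)
  then show ?thesis
    by simp
qed

text \<open>A complex inner product is determined by real ones; this transfers continuity and
  orthogonality statements from the real to the complex inner product.\<close>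

lemma cinner_eq_zero_iff_inner:
  "cinner x y = 0 \<longleftrightarrow> inner x y = 0 \<and> inner x (scaleC \<i> (y::'a::complex_hilbert_space)) = 0"
  by (simp add: inner_cinner cinner_scaleC_right complex_eq_iff)

lemma closed_cinner_eq_zero: "closed {x. cinner x (y::'a::complex_hilbert_space) = 0}"
proof -
  have "closed ({x. inner x y = 0} \<inter> {x. inner x (scaleC \<i> y) = 0})"
    by (intro closed_Int closed_Collect_eq continuous_intros)
  then show ?thesis
    by (simp add: cinner_eq_zero_iff_inner Collect_conj_eq)
qed

lemma norm_scaleC: "norm (scaleC c x) = cmod c * norm (x::'a::complex_hilbert_space)"
proof -
  have "complex_of_real ((norm (scaleC c x))\<^sup>2) = complex_of_real ((cmod c * norm x)\<^sup>2)"
    unfolding cinner_self[symmetric] cinner_scaleC_left cinner_scaleC_right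
    by (simp add: cinner_self power_mult_distrib complex_norm_square[of c] del: of_real_power)
  then have "(norm (scaleC c x))\<^sup>2 = (cmod c * norm x)\<^sup>2"
    using of_real_eq_iff by blast
  then show ?thesis
    by (simp add: power2_eq_iff_nonneg)
qed

lemma bounded_linear_scaleC: "bounded_linear (scaleC c :: 'a::complex_hilbert_space \<Rightarrow> 'a)"
  by (rule bounded_linear_intro[where K = "cmod c"])
    (simp_all add: scaleC_add_right scaleR_scaleC scaleC_scaleC norm_scaleC mult.commute)

text \<open>A crude Cauchy--Schwarz inequality; only boundedness is needed, so the factor 2 is harmless.\<close>

lemma norm_cinner_le: "cmod (cinner x y) \<le> 2 * norm x * norm (y::'a::complex_hilbert_space)"
proof -
  have re: "\<bar>Re (cinner x y)\<bar> \<le> norm x * norm y"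
    using Cauchy_Schwarz_ineq2[of x y] by (simp add: inner_cinner)
  have "Im (cinner x y) = inner x (scaleC \<i> y)"
    by (simp add: inner_cinner cinner_scaleC_right)
  then have im: "\<bar>Im (cinner x y)\<bar> \<le> norm x * norm y"
    using Cauchy_Schwarz_ineq2[of x "scaleC \<i> y"] by (simp add: norm_scaleC)
  show ?thesis
    using re im cmod_le[of "cinner x y"] by linarith
qed

section \<open>Orthogonal projections and adjoints\<close>

text \<open>The projection theorem. A minimizing sequence of distances from \<open>x\<close> to \<open>V\<close> is Cauchy by the
  parallelogram law; its limit is a nearest point, and variation shows orthogonality.\<close>

lemma orthogonal_projection_ex:
  fixes V :: "'a::{real_inner, complete_space} set"
  assumes V: "subspace V" and "closed V"
  obtains p where "p \<in> V" and "\<And>v. v \<in> V \<Longrightarrow> inner (x - p) v = 0"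
proof -
  define D where "D = (INF v\<in>V. (norm (x - v))\<^sup>2)"
  have ne: "V \<noteq> {}"
    using V subspace_0 by auto
  have bdd: "bdd_below ((\<lambda>v. (norm (x - v))\<^sup>2) ` V)"
    by (intro bdd_belowI[of _ 0]) auto
  have D_le: "D \<le> (norm (x - v))\<^sup>2" if "v \<in> V" for v
    unfolding D_def using bdd that by (rule cINF_lower)
  have "\<exists>v\<in>V. (norm (x - v))\<^sup>2 < D + 1 / real (Suc k)" for k
  proof -
    have "D < D + 1 / real (Suc k)"
      by simp
    then show ?thesis
      using cINF_less_iff[OF ne bdd] unfolding D_def by blast
  qed
  then obtain s where sV: "\<And>k. s k \<in> V"
    and s_less: "\<And>k. (norm (x - s k))\<^sup>2 < D + 1 / real (Suc k)"
    by metis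
  have par: "(norm (s i - s j))\<^sup>2 \<le> 2 / real (Suc i) + 2 / real (Suc j)" for i j
  proof -
    have "(1/2) *\<^sub>R (s i + s j) \<in> V"
      using V sV by (intro subspace_scale subspace_add)
    then have "D \<le> (norm (x - (1/2) *\<^sub>R (s i + s j)))\<^sup>2"
      by (rule D_le)
    moreover have "(norm (s i - s j))\<^sup>2 = 2 * (norm (x - s i))\<^sup>2 + 2 * (norm (x - s j))\<^sup>2
        - 4 * (norm (x - (1/2) *\<^sub>R (s i + s j)))\<^sup>2"
      unfolding power2_norm_eq_inner
      by (simp add: inner_diff_left inner_diff_right inner_add_left inner_add_right
          inner_commute algebra_simps)
    ultimately show ?thesis
      using s_less[of i] s_less[of j] by linarith
  qed
  have "Cauchy s"
  proof (rule CauchyI)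
    fix e :: real assume "0 < e"
    then obtain N where N: "inverse (real (Suc N)) < e\<^sup>2 / 4"
      using reals_Archimedean[of "e\<^sup>2 / 4"] by auto
    have "norm (s i - s j) < e" if "i \<ge> N" "j \<ge> N" for i j
    proof -
      have "1 / real (Suc i) \<le> 1 / real (Suc N)" "1 / real (Suc j) \<le> 1 / real (Suc N)"
        using that by (auto intro!: divide_left_mono)
      then have "(norm (s i - s j))\<^sup>2 < e\<^sup>2"
        using par[of i j] N by (simp add: inverse_eq_divide)
      then show ?thesis
        using \<open>0 < e\<close> by (simp add: power_less_imp_less_base)
    qed
    then show "\<exists>N. \<forall>i\<ge>N. \<forall>j\<ge>N. norm (s i - s j) < e"
      by blast
  qed
  then obtain p where lim: "s \<longlonglongrightarrow> p"
    using Cauchy_convergent_iff convergent_def by blast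
  have pV: "p \<in> V"
    using \<open>closed V\<close> sV lim closed_sequentially by blast
  have "(norm (x - p))\<^sup>2 \<le> D"
  proof (rule LIMSEQ_le)
    show "(\<lambda>k. (norm (x - s k))\<^sup>2) \<longlonglongrightarrow> (norm (x - p))\<^sup>2"
      by (intro tendsto_intros lim)
    show "(\<lambda>k. D + 1 / real (Suc k)) \<longlonglongrightarrow> D"
      using tendsto_add[OF tendsto_const LIMSEQ_inverse_real_of_nat, of D]
      by (simp add: inverse_eq_divide)
    show "\<exists>N. \<forall>k\<ge>N. (norm (x - s k))\<^sup>2 \<le> D + 1 / real (Suc k)"
      using s_less less_imp_le by blast
  qed
  then have near: "(norm (x - p))\<^sup>2 \<le> (norm (x - v))\<^sup>2" if "v \<in> V" for v
    using D_le[OF that] by linarith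
  have "inner (x - p) v = 0" if v: "v \<in> V" for v
  proof (cases "v = 0")
    case False
    \<comment> \<open>Moving from \<open>p\<close> by the orthogonal projection of \<open>x - p\<close> onto the line through \<open>v\<close> lowers the
      squared distance by \<open>\<langle>x - p, v\<rangle>\<^sup>2 / \<parallel>v\<parallel>\<^sup>2\<close>.\<close>
    have expand: "(norm (e - c *\<^sub>R v))\<^sup>2 = (norm e)\<^sup>2 - 2 * c * inner e v + c\<^sup>2 * inner v v" for e c
      unfolding power2_norm_eq_inner
      by (simp add: inner_diff_left inner_diff_right inner_commute power2_eq_square)
    define a where "a = inner (x - p) v"
    define b where "b = inner v v"
    have b: "b > 0"
      using False by (simp add: b_def)
    have "p + (a / b) *\<^sub>R v \<in> V"
      using V v pV by (intro subspace_scale subspace_add)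
    then have "(norm (x - p))\<^sup>2 \<le> (norm ((x - p) - (a / b) *\<^sub>R v))\<^sup>2"
      using near by (simp add: diff_diff_eq)
    also have "\<dots> = (norm (x - p))\<^sup>2 - 2 * (a / b) * a + (a / b)\<^sup>2 * b"
      by (simp add: expand a_def b_def)
    also have "\<dots> = (norm (x - p))\<^sup>2 - a\<^sup>2 / b"
      using b by (simp add: power2_eq_square field_simps)
    finally have "a\<^sup>2 / b \<le> 0"
      by simp
    then show ?thesis
      using b by (simp add: divide_le_0_iff a_def)
  qed simp
  with pV that show thesis
    by blast
qed

lemma closed_csubspace_subspace: "closed_csubspace V \<Longrightarrow> subspace V"
  by (auto simp: closed_csubspace_def subspace_def scaleR_scaleC)

lemma closed_csubspace_projection:
  assumes V: "closed_csubspace V"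
  shows "\<exists>p\<in>V. \<forall>v\<in>V. cinner (x - p) v = 0"
proof -
  obtain p where "p \<in> V" and orth: "\<And>v. v \<in> V \<Longrightarrow> inner (x - p) v = 0"
    using orthogonal_projection_ex[of V x] closed_csubspace_subspace[OF V] V
    unfolding closed_csubspace_def by blast
  moreover have "scaleC \<i> v \<in> V" if "v \<in> V" for v
    using V that by (simp add: closed_csubspace_def)
  ultimately show ?thesis
    by (auto simp: cinner_eq_zero_iff_inner)
qed

lemma closed_csubspace_closure:
  assumes "0 \<in> V" and "\<And>x y. x \<in> V \<Longrightarrow> y \<in> V \<Longrightarrow> x + y \<in> V"
    and "\<And>c x. x \<in> V \<Longrightarrow> scaleC c x \<in> V"
  shows "closed_csubspace (closure V)"
proof -
  have "(+) x ` closure V \<subseteq> closure V" if "x \<in> V" for x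
  proof (rule image_closure_subset)
    show "(+) x ` V \<subseteq> closure V"
      using assms(2) that closure_subset by blast
  qed (auto intro!: continuous_intros)
  \<comment> \<open>Addition is extended to the closure in one argument after the other.\<close>
  then have "(\<lambda>x. x + y) ` closure V \<subseteq> closure V" if "y \<in> closure V" for y
    using that by (intro image_closure_subset) (auto intro!: continuous_intros)
  then have add: "x + y \<in> closure V" if "x \<in> closure V" "y \<in> closure V" for x y
    using that by blast
  have "scaleC c ` closure V \<subseteq> closure V" for c
  proof (rule image_closure_subset)
    show "continuous_on (closure V) (scaleC c)"
      by (intro linear_continuous_on bounded_linear_scaleC)
    show "scaleC c ` V \<subseteq> closure V"
      using assms(3) closure_subset by blast
  qed simp
  then show ?thesis
    using add assms(1) closure_subset[of V] by (auto simp: closed_csubspace_def)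
qed

lemma bounded_op_bounded_linear:
  assumes "bounded_op UNIV UNIV T"
  shows "bounded_linear T"
proof -
  obtain B where "\<And>x. norm (T x) \<le> B * norm x"
    using assms by (auto simp: bounded_op_def)
  then show ?thesis
    using assms
    by (intro bounded_linear_intro[where K = B])
      (auto simp: bounded_op_def scaleR_scaleC mult.commute)
qed

text \<open>The Riesz representation theorem. Off the trivial case, the representing vector is a multiple
  of a vector orthogonal to the kernel of the functional.\<close>

lemma riesz_representation:
  fixes f :: "'a::complex_hilbert_space \<Rightarrow> complex"
  assumes f: "bounded_linear f" and fC: "\<And>c x. f (scaleC c x) = c * f x"
  shows "\<exists>z. \<forall>x. f x = cinner x z"
proof (cases "\<forall>x. f x = 0")
  case True
  then have "\<forall>x. f x = cinner x 0"
    by simp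
  then show ?thesis
    by (rule exI)
next
  case False
  then obtain v where v: "f v \<noteq> 0"
    by blast
  interpret f: bounded_linear f by fact
  have "closed {x. f x = 0}"
    by (intro closed_Collect_eq linear_continuous_on f continuous_on_const)
  then have "closed_csubspace {x. f x = 0}"
    by (simp add: closed_csubspace_def f.zero f.add fC)
  then have "\<exists>p\<in>{x. f x = 0}. \<forall>u\<in>{x. f x = 0}. cinner (v - p) u = 0"
    by (rule closed_csubspace_projection)
  then obtain p where p: "f p = 0" and orth: "\<And>u. f u = 0 \<Longrightarrow> cinner (v - p) u = 0"
    by auto
  define w where "w = v - p"
  have fw: "f w \<noteq> 0"
    using v p by (simp add: w_def f.diff)
  then have w: "cinner w w \<noteq> 0"
    using f.zero by auto
  define z where "z = scaleC (cnj (f w) / cnj (cinner w w)) w"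
  have "f x = cinner x z" for x
  proof -
    have "f (x - scaleC (f x / f w) w) = 0"
      using fw by (simp add: f.diff fC)
    then have "cinner w (x - scaleC (f x / f w) w) = 0"
      unfolding w_def by (rule orth)
    then have "cinner (x - scaleC (f x / f w) w) w = 0"
      by (simp only: cinner_eq_zero_commute[of _ w])
    then have "cinner x w = f x / f w * cinner w w"
      by (simp add: cinner_diff_left cinner_scaleC_left)
    then show ?thesis
      using fw w by (simp add: z_def cinner_scaleC_right)
  qed
  then show ?thesis
    by blast
qed

lemma adjoint_on_eqI:
  assumes "z \<in> V" and "\<And>x. x \<in> V \<Longrightarrow> cinner (A x) y = cinner x z"
    and diff: "\<And>u v. u \<in> V \<Longrightarrow> v \<in> V \<Longrightarrow> u - v \<in> V"
  shows "adjoint_on V A y = z"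
  unfolding adjoint_on_def
proof (rule the_equality)
  fix z' assume z': "z' \<in> V \<and> (\<forall>x\<in>V. cinner (A x) y = cinner x z')"
  then have "cinner (z' - z) (z' - z) = 0"
    using assms diff[of z' z] by (simp add: cinner_diff_right)
  then show "z' = z"
    by simp
qed (use assms in auto)

lemma cinner_adjoint_on_UNIV:
  assumes T: "bounded_op UNIV UNIV T"
  shows "cinner (T x) y = cinner x (adjoint_on UNIV T y)"
proof -
  interpret T: bounded_linear T
    using T by (rule bounded_op_bounded_linear)
  obtain B where B: "\<And>x. norm (T x) \<le> norm x * B"
    using T.bounded by blast
  have "bounded_linear (\<lambda>x. cinner (T x) y)"
  proof (rule bounded_linear_intro)
    fix x
    have "cmod (cinner (T x) y) \<le> 2 * norm (T x) * norm y"
      by (rule norm_cinner_le)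
    also have "\<dots> \<le> 2 * (norm x * B) * norm y"
      using B by (intro mult_right_mono mult_left_mono) auto
    finally show "norm (cinner (T x) y) \<le> norm x * (2 * B * norm y)"
      by (simp add: algebra_simps)
  next
    show "cinner (T (r *\<^sub>R x)) y = r *\<^sub>R cinner (T x) y" for r x
      unfolding T.scaleR by (simp add: scaleR_scaleC[of r "T x"] cinner_scaleC_left scaleR_conv_of_real)
  qed (simp add: T.add cinner_add_left)
  moreover have "cinner (T (scaleC c x)) y = c * cinner (T x) y" for c x
    using T by (simp add: bounded_op_def cinner_scaleC_left)
  ultimately obtain z where z: "\<And>x. cinner (T x) y = cinner x z"
    using riesz_representation[of "\<lambda>x. cinner (T x) y"] by blast
  then have "adjoint_on UNIV T y = z"
    by (intro adjoint_on_eqI) auto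
  then show ?thesis
    using z by simp
qed

section \<open>An operator whose power commutes with its modulus\<close>

text \<open>An operator \<open>T\<close> with adjoint \<open>S\<close> and a positive \<open>m\<close> such that \<open>T\<^sup>m\<close> commutes with \<open>S T\<close>.\<close>

locale power_quasinormal =
  fixes T S :: "'a::complex_hilbert_space \<Rightarrow> 'a" and m :: nat
  assumes T: "bounded_op UNIV UNIV T"
    and adj: "cinner (T x) y = cinner x (S y)"
    and m_pos: "0 < m"
    and comm_m: "(T ^^ m) (S (T x)) = S (T ((T ^^ m) x))"
begin

sublocale T: bounded_linear T
  using T by (rule bounded_op_bounded_linear)

lemma T_scaleC: "T (scaleC c x) = scaleC c (T x)"
  using T by (simp add: bounded_op_def)

lemma adj': "cinner (S x) y = cinner x (T y)"
  using adj[of y x] cinner_commute[of "S x" y] cinner_commute[of x "T y"] by simp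

lemma S_zero [simp]: "S 0 = 0"
  by (rule eq_if_cinner_eq) (simp add: adj[symmetric])

lemma T_pow_linear:
  "(T ^^ j) (x + y) = (T ^^ j) x + (T ^^ j) y"
  "(T ^^ j) (x - y) = (T ^^ j) x - (T ^^ j) y"
  "(T ^^ j) (scaleC c x) = scaleC c ((T ^^ j) x)"
  "(T ^^ j) 0 = 0"
proof -
  show "(T ^^ j) (x + y) = (T ^^ j) x + (T ^^ j) y"
    by (induction j) (simp_all add: T.add)
  show "(T ^^ j) (x - y) = (T ^^ j) x - (T ^^ j) y"
    by (induction j) (simp_all add: T.diff)
  show "(T ^^ j) (scaleC c x) = scaleC c ((T ^^ j) x)"
    by (induction j) (simp_all add: T_scaleC)
  show "(T ^^ j) 0 = 0"
    by (induction j) (simp_all add: T.zero)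
qed

lemma adj_pow: "cinner ((T ^^ j) x) y = cinner x ((S ^^ j) y)"
  by (induction j arbitrary: y) (simp_all add: adj flip: funpow_swap1)

lemma S_pow_comm: "(S ^^ m) (S (T x)) = S (T ((S ^^ m) x))"
proof (rule eq_if_cinner_eq)
  fix u
  have ST: "cinner (S (T a)) b = cinner a (S (T b))" for a b
    by (simp only: adj adj')
  have "cinner u ((S ^^ m) (S (T x))) = cinner (S (T ((T ^^ m) u))) x"
    by (simp only: adj_pow ST)
  also have "\<dots> = cinner ((T ^^ m) (S (T u))) x"
    by (simp only: comm_m)
  also have "\<dots> = cinner u (S (T ((S ^^ m) x)))"
    by (simp only: adj_pow ST)
  finally show "cinner u ((S ^^ m) (S (T x))) = cinner u (S (T ((S ^^ m) x)))" .
qed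

lemma ST_eq_zero: "S (T x) = 0 \<Longrightarrow> T x = 0"
  by (metis adj cinner_zero_right cinner_self_eq_zero)

lemma S_pow_eq_zero_if_ker:
  assumes "T y = 0"
  shows "(S ^^ m) y = 0"
proof -
  have S0: "(S ^^ j) 0 = 0" for j
    by (induction j) simp_all
  have "S (T ((S ^^ m) y)) = 0"
    using S_pow_comm[of y] assms S0 by simp
  then have "T ((S ^^ m) y) = 0"
    by (rule ST_eq_zero)
  moreover obtain j where "m = Suc j"
    using m_pos gr0_implies_Suc by blast
  ultimately have "(T ^^ m) ((S ^^ m) y) = 0"
    by (simp add: funpow_Suc_right T_pow_linear del: funpow.simps)
  then have "cinner ((S ^^ m) y) ((S ^^ m) y) = 0"
    using adj_pow[of m "(S ^^ m) y" y] by simp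
  then show ?thesis
    by simp
qed

text \<open>The closure of the range of \<open>T\<^sup>m\<close>.\<close>

definition M :: "'a set" where "M = closure (range (T ^^ m))"

text \<open>The kernel of \<open>S\<^sup>m\<close>. Lemmas \<open>K_iff\<close> and \<open>M_iff\<close> below show that \<open>K\<close> and \<open>M\<close> are orthogonal
  complements of each other; invariance of \<open>M\<close> is then read off from that of \<open>K\<close>.\<close>

definition K :: "'a set" where "K = {x. (S ^^ m) x = 0}"

lemma K_iff: "x \<in> K \<longleftrightarrow> (\<forall>u. cinner ((T ^^ m) u) x = 0)"
  unfolding K_def adj_pow by (auto dest: spec[of _ "(S ^^ m) x"])

lemma closed_csubspace_M: "closed_csubspace M"
  unfolding M_def
proof (rule closed_csubspace_closure)
  show "0 \<in> range (T ^^ m)"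
    using rangeI[of "T ^^ m" 0] by (simp add: T_pow_linear)
  show "x + y \<in> range (T ^^ m)" if "x \<in> range (T ^^ m)" "y \<in> range (T ^^ m)" for x y
    using that by (auto simp flip: T_pow_linear)
  show "scaleC c x \<in> range (T ^^ m)" if "x \<in> range (T ^^ m)" for c x
    using that by (auto simp flip: T_pow_linear)
qed

lemma closed_csubspace_K: "closed_csubspace K"
proof -
  have K_eq: "K = (\<Inter>u. {x. cinner x ((T ^^ m) u) = 0})"
    by (auto simp: K_iff cinner_eq_zero_commute)
  have "closed K"
    unfolding K_eq by (intro closed_INT ballI closed_cinner_eq_zero)
  moreover have "0 \<in> K" "\<And>x y. x \<in> K \<Longrightarrow> y \<in> K \<Longrightarrow> x + y \<in> K"
    "\<And>c x. x \<in> K \<Longrightarrow> scaleC c x \<in> K"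
    by (simp_all add: K_iff cinner_add_right cinner_scaleC_right)
  ultimately show ?thesis
    by (simp add: closed_csubspace_def)
qed

lemma pow_m_in_M: "(T ^^ m) x \<in> M"
  unfolding M_def using closure_subset[of "range (T ^^ m)"] by auto

lemma M_diff: "x \<in> M \<Longrightarrow> y \<in> M \<Longrightarrow> x - y \<in> M"
  by (rule subspace_diff[OF closed_csubspace_subspace[OF closed_csubspace_M]])

lemma K_diff: "x \<in> K \<Longrightarrow> y \<in> K \<Longrightarrow> x - y \<in> K"
  by (rule subspace_diff[OF closed_csubspace_subspace[OF closed_csubspace_K]])

lemma M_orth_K:
  assumes "u \<in> M" "v \<in> K"
  shows "cinner u v = 0"
proof -
  have "M \<subseteq> {u. cinner u v = 0}"
    unfolding M_def
    by (rule closure_minimal) (use assms in \<open>auto simp: K_iff closed_cinner_eq_zero\<close>)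
  then show ?thesis
    using assms by blast
qed

lemma decompose: "\<exists>u\<in>M. \<exists>v\<in>K. x = u + v"
proof -
  obtain u where u: "u \<in> M" "\<And>w. w \<in> M \<Longrightarrow> cinner (x - u) w = 0"
    using closed_csubspace_projection[OF closed_csubspace_M, of x] by blast
  then have "cinner ((T ^^ m) w) (x - u) = 0" for w
    by (simp only: cinner_eq_zero_commute[of _ "x - u"] pow_m_in_M)
  then have "x - u \<in> K"
    by (simp add: K_iff)
  moreover have "x = u + (x - u)"
    by simp
  ultimately show ?thesis
    using u by blast
qed

lemma orthogonal_decomposition_M_K: "orthogonal_decomposition M K"
  unfolding orthogonal_decomposition_def
  using closed_csubspace_M closed_csubspace_K M_orth_K decompose by blast

lemma M_iff: "x \<in> M \<longleftrightarrow> (\<forall>v\<in>K. cinner x v = 0)"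
proof
  assume orth: "\<forall>v\<in>K. cinner x v = 0"
  obtain u v where uv: "u \<in> M" "v \<in> K" "x = u + v"
    using decompose by blast
  then have "cinner v v = 0"
    using orth M_orth_K by (simp add: cinner_add_left)
  then show "x \<in> M"
    using uv by simp
qed (use M_orth_K in blast)

lemma M_inter_K: "x \<in> M \<Longrightarrow> x \<in> K \<Longrightarrow> x = 0"
  using M_orth_K cinner_self_eq_zero by blast

lemma T_in_M:
  assumes "x \<in> M"
  shows "T x \<in> M"
proof -
  have "S v \<in> K" if "v \<in> K" for v
    using that by (simp add: K_def funpow_swap1[of S, symmetric])
  then show ?thesis
    using assms by (simp add: M_iff adj)
qed

lemma T_pow_in_M: "x \<in> M \<Longrightarrow> (T ^^ j) x \<in> M"
  by (induction j) (simp_all add: T_in_M)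

lemma ST_in_M:
  assumes "x \<in> M"
  shows "S (T x) \<in> M"
proof -
  have "S (T v) \<in> K" if "v \<in> K" for v
  proof -
    have "(S ^^ m) (S (T v)) = S (T ((S ^^ m) v))"
      by (rule S_pow_comm)
    then show ?thesis
      using that unfolding K_def by (simp only: mem_Collect_eq T.zero S_zero)
  qed
  moreover have "cinner (S (T x)) v = cinner x (S (T v))" for v
    by (simp only: adj adj')
  ultimately show ?thesis
    using assms by (simp only: M_iff) blast
qed

lemma inj_on_M: "x \<in> M \<Longrightarrow> T x = 0 \<Longrightarrow> x = 0"
  by (rule M_inter_K) (simp_all add: K_def S_pow_eq_zero_if_ker)

lemma pow_inj_on_M: "x \<in> M \<Longrightarrow> (T ^^ j) x = 0 \<Longrightarrow> x = 0"
proof (induction j)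
  case (Suc j)
  then have "(T ^^ j) x = 0"
    using inj_on_M[OF T_pow_in_M] by simp
  with Suc show ?case
    by blast
qed simp

text \<open>With \<open>P\<close> the orthogonal projection onto \<open>M\<close>, the second column of the matrix is \<open>P T\<close> and
  \<open>(1 - P) T\<close>; the lower left entry vanishes because \<open>M\<close> is invariant under \<open>T\<close>.\<close>

lemma has_matrix_restrict: "\<exists>X N. has_matrix M K T (restrict T M) X (\<lambda>_. 0) N"
proof -
  have "\<exists>u. u \<in> M \<and> x - u \<in> K" for x
  proof -
    obtain u v where uv: "u \<in> M" "v \<in> K" "x = u + v"
      using decompose by blast
    then have "x - u = v"
      by simp
    with uv show ?thesis
      by metis
  qed
  then obtain P where P: "\<And>x. P x \<in> M" "\<And>x. x - P x \<in> K"
    by metis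
  have P_eqI: "P x = u" if "u \<in> M" "x - u \<in> K" for x u
  proof -
    have "P x - u = (x - u) - (x - P x)"
      by simp
    then have "P x - u \<in> K"
      using K_diff P that by metis
    then show ?thesis
      using M_inter_K M_diff P that by force
  qed
  have P_add: "P (x + y) = P x + P y" for x y
  proof (rule P_eqI)
    show "P x + P y \<in> M"
      using P closed_csubspace_M by (simp add: closed_csubspace_def)
    have "(x - P x) + (y - P y) \<in> K"
      using P closed_csubspace_K by (simp add: closed_csubspace_def)
    then show "x + y - (P x + P y) \<in> K"
      by (simp add: algebra_simps)
  qed
  have P_scale: "P (scaleC c x) = scaleC c (P x)" for c x
  proof (rule P_eqI)
    show "scaleC c (P x) \<in> M"
      using P closed_csubspace_M by (simp add: closed_csubspace_def)
    show "scaleC c x - scaleC c (P x) \<in> K"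
      using P closed_csubspace_K by (simp add: closed_csubspace_def flip: scaleC_diff_right)
  qed
  have pyth: "(norm x)\<^sup>2 = (norm (P x))\<^sup>2 + (norm (x - P x))\<^sup>2" for x
  proof -
    have "inner (P x) (x - P x) = 0"
      using M_orth_K[OF P] by (simp add: inner_cinner)
    then show ?thesis
      unfolding power2_norm_eq_inner
      by (simp add: inner_diff_left inner_diff_right inner_commute)
  qed
  have norm_P: "norm (P x) \<le> norm x" and norm_Q: "norm (x - P x) \<le> norm x" for x
    using pyth[of x] by (simp_all add: norm_le_square power2_norm_eq_inner[symmetric]
        power2_le_imp_le)
  obtain B where B: "\<And>x. norm (T x) \<le> B * norm x"
    using T by (auto simp: bounded_op_def)
  have PT: "norm (P (T x)) \<le> B * norm x" and QT: "norm (T x - P (T x)) \<le> B * norm x" for x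
    using norm_P[of "T x"] norm_Q[of "T x"] B[of x] by linarith+
  have "bounded_op M M (restrict T M)"
    using closed_csubspace_M B
    by (auto simp: bounded_op_def closed_csubspace_def T_in_M T.add T_scaleC)
  moreover have "bounded_op K M (\<lambda>x. P (T x))"
    using P PT by (auto simp: bounded_op_def T.add T_scaleC P_add P_scale)
  moreover have "bounded_op M K (\<lambda>_. 0)"
    using closed_csubspace_K by (auto simp: bounded_op_def closed_csubspace_def intro: exI[of _ 0])
  moreover have "bounded_op K K (\<lambda>x. T x - P (T x))"
    using P QT by (auto simp: bounded_op_def T.add T_scaleC P_add P_scale scaleC_diff_right)
  ultimately have "has_matrix M K T (restrict T M) (\<lambda>x. P (T x)) (\<lambda>_. 0) (\<lambda>x. T x - P (T x))"
    by (simp add: has_matrix_def T.add)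
  then show ?thesis
    by blast
qed

section \<open>Index sets of the operator and of its restriction\<close>

lemma adjoint_on_UNIV: "adjoint_on UNIV T = S"
  by (rule ext, rule adjoint_on_eqI) (simp_all add: adj)

lemma PQ_on_UNIV_iff:
  "j \<in> PQ_on UNIV T \<longleftrightarrow> 0 < j \<and> (\<forall>x. (T ^^ j) (S (T x)) = S (T ((T ^^ j) x)))"
  by (simp add: PQ_on_def power_quasinormal_on_def commutator_def adjoint_on_UNIV)

lemma restrict_pow: "x \<in> M \<Longrightarrow> (restrict T M ^^ j) x = (T ^^ j) x"
  by (induction j) (simp_all add: T_pow_in_M)

text \<open>Since \<open>S T\<close> leaves \<open>M\<close> invariant, the adjoint taken in \<open>M\<close> needs no projection on the range
  of the restriction.\<close>

lemma adjoint_on_restrict: "x \<in> M \<Longrightarrow> adjoint_on M (restrict T M) (T x) = S (T x)"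
  by (rule adjoint_on_eqI) (simp_all add: ST_in_M adj M_diff)

lemma PQ_on_M_iff:
  "j \<in> PQ_on M (restrict T M) \<longleftrightarrow>
    0 < j \<and> (\<forall>x\<in>M. (T ^^ j) (S (T x)) = S (T ((T ^^ j) x)))"
  by (simp add: PQ_on_def power_quasinormal_on_def commutator_def adjoint_on_restrict restrict_pow
      ST_in_M T_pow_in_M)

lemma PQ_on_M_add:
  assumes "i \<in> PQ_on M (restrict T M)" and "j \<in> PQ_on M (restrict T M)"
  shows "i + j \<in> PQ_on M (restrict T M)"
  using assms by (simp add: PQ_on_M_iff funpow_add T_pow_in_M)

lemma PQ_on_M_diff:
  assumes i: "i \<in> PQ_on M (restrict T M)" and j: "j \<in> PQ_on M (restrict T M)" and "i < j"
  shows "j - i \<in> PQ_on M (restrict T M)"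
proof -
  define k where "k = j - i"
  have j_eq: "j = i + k"
    using \<open>i < j\<close> by (simp add: k_def)
  have "(T ^^ k) (S (T x)) = S (T ((T ^^ k) x))" if x: "x \<in> M" for x
  proof -
    have "(T ^^ i) ((T ^^ k) (S (T x))) = S (T ((T ^^ i) ((T ^^ k) x)))"
      using j x unfolding PQ_on_M_iff j_eq funpow_add by simp
    also have "\<dots> = (T ^^ i) (S (T ((T ^^ k) x)))"
      using i x by (simp add: PQ_on_M_iff T_pow_in_M)
    finally have "(T ^^ i) ((T ^^ k) (S (T x)) - S (T ((T ^^ k) x))) = 0"
      by (simp add: T_pow_linear)
    moreover have "(T ^^ k) (S (T x)) - S (T ((T ^^ k) x)) \<in> M"
      using x by (intro M_diff T_pow_in_M ST_in_M)
    ultimately show ?thesis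
      using pow_inj_on_M by force
  qed
  then show ?thesis
    using \<open>i < j\<close> by (simp add: PQ_on_M_iff k_def)
qed

text \<open>From exponent \<open>m\<close> on, commuting on \<open>M\<close> already implies commuting on the whole space.\<close>

lemma PQ_on_UNIV_eq_PQ_on_M:
  assumes "m \<le> j"
  shows "j \<in> PQ_on UNIV T \<longleftrightarrow> j \<in> PQ_on M (restrict T M)"
proof
  assume j: "j \<in> PQ_on M (restrict T M)"
  define k where "k = j - m"
  have j_eq: "j = m + k" and j_eq': "j = k + m"
    using assms by (simp_all add: k_def)
  have "(T ^^ j) (S (T x)) = S (T ((T ^^ j) x))" for x
  proof -
    define D where "D = (T ^^ j) (S (T x)) - S (T ((T ^^ j) x))"
    have swap: "(T ^^ m) ((T ^^ j) u) = (T ^^ j) ((T ^^ m) u)" for u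
      by (metis add.commute comp_apply funpow_add)
    have "D = (T ^^ m) ((T ^^ k) (S (T x)) - S (T ((T ^^ k) x)))"
      by (simp add: D_def j_eq funpow_add T_pow_linear comm_m)
    then have "D \<in> M"
      using pow_m_in_M by simp
    moreover have "(T ^^ m) D = 0"
    proof -
      have "(T ^^ m) D = (T ^^ j) (S (T ((T ^^ m) x))) - S (T ((T ^^ j) ((T ^^ m) x)))"
        by (simp add: D_def T_pow_linear comm_m swap)
      also have "\<dots> = 0"
        using j pow_m_in_M by (simp add: PQ_on_M_iff)
      finally show ?thesis .
    qed
    ultimately have "D = 0"
      by (rule pow_inj_on_M)
    then show ?thesis
      by (simp add: D_def)
  qed
  then show "j \<in> PQ_on UNIV T"
    using j by (simp add: PQ_on_UNIV_iff PQ_on_M_iff)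
qed (simp add: PQ_on_UNIV_iff PQ_on_M_iff)

end

section \<open>Sets of positive integers closed under sums and differences\<close>

text \<open>Such a set consists of the positive multiples of its least element, by Euclidean descent.\<close>

lemma add_diff_closed_eq_multiples:
  fixes P :: "nat set"
  assumes pos: "\<And>i. i \<in> P \<Longrightarrow> 0 < i" and d: "d \<in> P" and least: "\<And>i. i \<in> P \<Longrightarrow> d \<le> i"
    and add: "\<And>i j. i \<in> P \<Longrightarrow> j \<in> P \<Longrightarrow> i + j \<in> P"
    and diff: "\<And>i j. i \<in> P \<Longrightarrow> j \<in> P \<Longrightarrow> i < j \<Longrightarrow> j - i \<in> P"
  shows "i \<in> P \<longleftrightarrow> 0 < i \<and> d dvd i"
proof
  show "i \<in> P \<Longrightarrow> 0 < i \<and> d dvd i"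
  proof (induction i rule: less_induct)
    case (less i)
    show ?case
    proof (cases "i = d")
      case False
      then have "d < i"
        using less.prems least by (simp add: order_less_le)
      then have "d dvd i - d"
        using less d diff pos[OF d] by simp
      then show ?thesis
        using \<open>d < i\<close> by (simp add: dvd_minus_self)
    qed (use less.prems pos in simp)
  qed
next
  have mult: "d * Suc k \<in> P" for k
    using d add by (induction k) simp_all
  assume "0 < i \<and> d dvd i"
  then obtain k where "i = d * k" "k \<noteq> 0"
    by (auto elim: dvdE)
  then show "i \<in> P"
    using mult not0_implies_Suc by blast
qed

text \<open>The parameters of a tail of multiples are its least element \<open>d q\<close> and the gap \<open>d\<close> after it.\<close>

lemma multiples_tail_unique:
  fixes d q d' q' :: nat
  assumes "0 < d" "0 < d'" and eq: "{d * (q + k) | k::nat. True} = {d' * (q' + k) | k::nat. True}"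
  shows "d = d'" and "q = q'"
proof -
  have le: "e * r \<le> d * q \<and> e * (r + 1) \<le> d * (q + 1)"
    if "0 < d" "0 < e" and eq: "{d * (q + k) | k::nat. True} = {e * (r + k) | k::nat. True}"
    for d q e r :: nat
  proof -
    have "d * (q + 0) \<in> {e * (r + k) | k::nat. True}" "d * (q + 1) \<in> {e * (r + k) | k::nat. True}"
      unfolding eq[symmetric] by blast+
    then obtain a b where a: "d * q = e * (r + a)" and b: "d * (q + 1) = e * (r + b)"
      unfolding mem_Collect_eq add_0_right by blast
    have "e * (r + 1) \<le> d * (q + 1)"
    proof (cases b)
      case 0
      \<comment> \<open>This case is contradictory: \<open>d (q + 1)\<close> would be the least element \<open>e r\<close>, although \<open>d q\<close> is
        a smaller element.\<close>
      then have "e * (r + a) < e * r"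
        using a b that(1) by (simp add: distrib_left)
      then show ?thesis
        by simp
    next
      case (Suc b')
      then show ?thesis
        using b by (simp add: distrib_left)
    qed
    then show ?thesis
      using a by (simp add: distrib_left)
  qed
  have 1: "d * q = d' * q'" and 2: "d * (q + 1) = d' * (q' + 1)"
    using le[OF assms] le[OF assms(2,1) eq[symmetric]] by auto
  then show "d = d'"
    by simp
  then show "q = q'"
    using 1 \<open>0 < d\<close> by simp
qed

section \<open>The power-quasinormality index set\<close>

theorem theorem3p3:
  fixes T :: "'a::complex_hilbert_space \<Rightarrow> 'a" and n :: nat
  assumes "0 < n"
    and "bounded_op UNIV UNIV T"
    and "power_quasinormal_on UNIV n T"
  shows "(\<exists>!(d, q). 0 < d \<and> 0 < q \<and> PQ_on UNIV T = {d * (q + k) | k::nat. True}) \<and>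
    (let m = (LEAST j. j \<in> PQ_on UNIV T);
         M = closure (range (T ^^ m));
         K = {x. (adjoint_on UNIV T ^^ m) x = 0};
         T' = restrict T M
     in orthogonal_decomposition M K \<and>
        (\<exists>X N. has_matrix M K T T' X (\<lambda>_. 0) N) \<and>
        PQ_on M T' \<noteq> {} \<and>
        (\<forall>d q. 0 < d \<and> 0 < q \<and> PQ_on UNIV T = {d * (q + k) | k::nat. True} \<longrightarrow>
           d = (LEAST j. j \<in> PQ_on M T') \<and> real q = real m / real d))"
proof -
  define m where "m = (LEAST j. j \<in> PQ_on UNIV T)"
  define S where "S = adjoint_on UNIV T"
  have "n \<in> PQ_on UNIV T"
    using assms by (simp add: PQ_on_def)
  then have m: "m \<in> PQ_on UNIV T"
    unfolding m_def by (rule LeastI)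
  have m_le: "m \<le> j" if "j \<in> PQ_on UNIV T" for j
    unfolding m_def using that by (rule Least_le)
  interpret power_quasinormal T S m
  proof
    show "bounded_op UNIV UNIV T" by fact
    show "cinner (T x) y = cinner x (S y)" for x y
      unfolding S_def using assms(2) by (rule cinner_adjoint_on_UNIV)
    show "0 < m" "(T ^^ m) (S (T x)) = S (T ((T ^^ m) x))" for x
      using m by (simp_all add: PQ_on_def power_quasinormal_on_def commutator_def S_def)
  qed
  define P where "P = PQ_on M (restrict T M)"
  define d where "d = (LEAST j. j \<in> P)"
  have mP: "m \<in> P"
    using m PQ_on_UNIV_eq_PQ_on_M[of m] by (simp add: P_def)
  have P_pos: "0 < i" if "i \<in> P" for i
    using that by (simp add: P_def PQ_on_def)
  have dP: "d \<in> P"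
    unfolding d_def using mP by (rule LeastI)
  have d_le: "d \<le> i" if "i \<in> P" for i
    unfolding d_def using that by (rule Least_le)
  have P_iff: "i \<in> P \<longleftrightarrow> 0 < i \<and> d dvd i" for i
    using P_pos dP d_le PQ_on_M_add[folded P_def] PQ_on_M_diff[folded P_def]
    by (rule add_diff_closed_eq_multiples)
  have "d dvd m"
    using mP P_iff[of m] by simp
  then obtain q where q: "m = d * q"
    by (rule dvdE)
  have d_pos: "0 < d" and q_pos: "0 < q"
    using m_pos q by auto
  have "j \<in> PQ_on UNIV T \<longleftrightarrow> (\<exists>k. j = d * (q + k))" for j
  proof -
    have "j \<in> PQ_on UNIV T \<longleftrightarrow> m \<le> j \<and> d dvd j"
      \<comment> \<open>Indices below the minimum \<open>m\<close> are excluded; from \<open>m\<close> on, the two index sets agree.\<close>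
      using m_le[of j] m_pos PQ_on_UNIV_eq_PQ_on_M[of j, folded P_def] P_iff[of j] by linarith
    also have "\<dots> \<longleftrightarrow> (\<exists>k. j = d * (q + k))"
    proof
      assume "m \<le> j \<and> d dvd j"
      then obtain r where "j = d * r" "m \<le> j"
        unfolding dvd_def by blast
      moreover from this have "q \<le> r"
        using d_pos q by simp
      ultimately show "\<exists>k. j = d * (q + k)"
        using le_Suc_ex by blast
    qed (auto simp: q)
    finally show ?thesis .
  qed
  then have PQ: "PQ_on UNIV T = {d * (q + k) | k::nat. True}"
    by blast
  have unique: "d' = d \<and> q' = q"
    if "0 < d'" "PQ_on UNIV T = {d' * (q' + k) | k::nat. True}" for d' q'
    using multiples_tail_unique[OF that(1) d_pos that(2)[symmetric, unfolded PQ]] by simp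
  have "\<exists>!(d, q). 0 < d \<and> 0 < q \<and> PQ_on UNIV T = {d * (q + k) | k::nat. True}"
  proof (rule ex1I[of _ "(d, q)"])
    show "case (d, q) of (d, q) \<Rightarrow> 0 < d \<and> 0 < q \<and> PQ_on UNIV T = {d * (q + k) | k::nat. True}"
      unfolding prod.case using d_pos q_pos PQ by (intro conjI)
    show "z = (d, q)"
      if "case z of (d, q) \<Rightarrow> 0 < d \<and> 0 < q \<and> PQ_on UNIV T = {d * (q + k) | k::nat. True}" for z
      using that unique[of "fst z" "snd z"] unfolding case_prod_beta by (metis prod.collapse)
  qed
  moreover have "d' = d \<and> real q' = real m / real d'"
    if "0 < d' \<and> 0 < q' \<and> PQ_on UNIV T = {d' * (q' + k) | k::nat. True}" for d' q'
  proof -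
    have "d' = d \<and> q' = q"
      using that by (intro unique) blast+
    then show ?thesis
      using q d_pos by simp
  qed
  ultimately show ?thesis
    unfolding m_def[symmetric] S_def[symmetric] Let_def M_def[symmetric] K_def[symmetric]
      P_def[symmetric] d_def[symmetric]
    using orthogonal_decomposition_M_K has_matrix_restrict mP
    by (intro conjI allI impI) blast+
qed

end
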